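(* Let $\mathcal{X}$ be a MIF$(k)$ and let $\mathcal{F}$ be a subfamily of $\mathcal{X}$ such that $t:=\mathrm{tr}(\mathcal{F})\le k-1$ and $\mathcal{X}\smallsetminus\mathcal{F}=\mathcal{A}\circledast\mathcal{F}^{\top}$ for some family $\mathcal{A}$. Then $\mathcal{F}$ is a CIF$(k,t)$ if and only if $\mathcal{A}$ is a MIF$(k-t)$.
   Context: A family is a non-empty set of non-empty finite sets, called its blocks. The point set of a family $\mathcal{G}$ is $P_{\mathcal{G}}=\bigcup_{B\in\mathcal{G}}B$. A family is uniform if all its blocks have the same size, denoted $\mathrm{k}(\mathcal{G})$. A blocking set of $\mathcal{G}$ is a set meeting every block of $\mathcal{G}$. If $\mathcal{G}$ has a finite blocking set, $\mathrm{tr}(\mathcal{G})$ is the smallest size of a blocking set, a transversal is a blocking set of size $\mathrm{tr}(\mathcal{G})$, and $\mathcal{G}^{\top}$ is the family of all transversals of $\mathcal{G}$; otherwise $\mathrm{tr}(\mathcal{G})=\infty$. The symbol $\sqcup$ denotes disjoint union (of sets or of families). The product $\mathcal{G}\circledast\mathcal{H}=\{A\sqcup B: A\in\mathcal{G},B\in\mathcal{H}\}$ is defined only when $P_{\mathcal{G}}\cap P_{\mathcal{H}}=\emptyset$ (so writing it includes this assumption). A MIF$(k)$ is a uniform family $\mathcal{F}$ with $\mathrm{k}(\mathcal{F})=k$, $\mathrm{tr}(\mathcal{F})<\infty$ and $\mathcal{F}=\mathcal{F}^{\top}$. A CIF$(k,t)$ is a uniform family $\mathcal{F}$ with $\mathrm{k}(\mathcal{F})=k$,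 $\mathrm{tr}(\mathcal{F})=t\le k-1$ and $\mathcal{F}=(\mathcal{F}\sqcup\mathcal{F}^{\top})^{\top}$. *)

theory Defs
  imports Main "HOL-Library.Extended_Nat"
begin

definition is_family :: "'a set set \<Rightarrow> bool" where
  "is_family G \<longleftrightarrow> G \<noteq> {} \<and> (\<forall>B\<in>G. finite B \<and> B \<noteq> {})"

definition point_set :: "'a set set \<Rightarrow> 'a set" where
  "point_set G = \<Union>G"

(* The block size is determined by the family, since families are non-empty. *)
definition uniform_family :: "nat \<Rightarrow> 'a set set \<Rightarrow> bool" where
  "uniform_family k G \<longleftrightarrow> is_family G \<and> (\<forall>B\<in>G. card B = k)"

definition blocking_set :: "'a set set \<Rightarrow> 'a set \<Rightarrow> bool" where
  "blocking_set G S \<longleftrightarrow> (\<forall>B\<in>G. S \<inter> B \<noteq> {})"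

definition tr :: "'a set set \<Rightarrow> enat" where
  "tr G = (if \<exists>S. finite S \<and> blocking_set G S
           then enat (LEAST n. \<exists>S. finite S \<and> blocking_set G S \<and> card S = n)
           else \<infinity>)"

(* The family of all transversals, written with a superscript \<top> in the literature.
   It is empty (hence not a family) when tr G is infinite. *)
definition transversals :: "'a set set \<Rightarrow> 'a set set" where
  "transversals G = {S. finite S \<and> blocking_set G S \<and> enat (card S) = tr G}"

(* The product of two families is only meaningful when their point sets are disjoint;
   family_prod is total, so this must be stated as a separate hypothesis at each use. *)
definition family_prod :: "'a set set \<Rightarrow> 'a set set \<Rightarrow> 'a set set" where
  "family_prod G H = {A \<union> B | A B. A \<in> G \<and> B \<in> H}"

definition MIF :: "nat \<Rightarrow> 'a set set \<Rightarrow> bool" where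
  "MIF k F \<longleftrightarrow> uniform_family k F \<and> tr F < \<infinity> \<and> F = transversals F"

(* k - 1 is not truncated: uniform_family k F forces k \<ge> 1.
   The disjointness conjunct records that the union of F and its transversals is a
   disjoint one; it is automatic because the block sizes k and t differ. *)
definition CIF :: "nat \<Rightarrow> nat \<Rightarrow> 'a set set \<Rightarrow> bool" where
  "CIF k t F \<longleftrightarrow> uniform_family k F \<and> tr F = enat t \<and> t \<le> k - 1 \<and>
     F \<inter> transversals F = {} \<and> F = transversals (F \<union> transversals F)"

end

(* Both sides of the equivalence hold under the hypotheses alone.  Write T for the family of
   transversals of F.  A set that blocks F and T also blocks X - F, hence X, and so has at least
   k points.  In particular no transversal of F blocks T; that is, every member of T is disjoint
   from some other one.  As the points of A lie outside those of T, this shows that no block of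
   X - F blocks T, which makes F a CIF, and that the blocks of A meet pairwise.  Finally, a
   blocking set S of A yields the blocking sets S \<union> T0 of X for all T0 in T. *)

theory Submission
  imports Defs
begin

lemma blocking_set_Un: "blocking_set (G \<union> H) S \<longleftrightarrow> blocking_set G S \<and> blocking_set H S"
  by (auto simp: blocking_set_def)

lemma blocking_set_mono: "blocking_set G R \<Longrightarrow> R \<subseteq> S \<Longrightarrow> blocking_set G S"
  unfolding blocking_set_def by blast

lemma tr_le_card:
  assumes "finite S" "blocking_set G S"
  shows "tr G \<le> enat (card S)"
  using assms unfolding tr_def by (auto intro: Least_le)

lemma tr_eqI:
  assumes "finite S" "blocking_set G S"
    and "\<And>R. finite R \<Longrightarrow> blocking_set G R \<Longrightarrow> card S \<le> card R"
  shows "tr G = enat (card S)"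
proof -
  have "(LEAST n. \<exists>R. finite R \<and> blocking_set G R \<and> card R = n) = card S"
    by (rule Least_equality) (use assms in auto)
  with assms(1,2) show ?thesis
    unfolding tr_def by auto
qed

lemma transversals_nonempty:
  assumes "tr G = enat n"
  shows "transversals G \<noteq> {}"
proof -
  have ex: "\<exists>m S. finite S \<and> blocking_set G S \<and> card S = m"
    using assms unfolding tr_def by (metis enat.distinct(2))
  have "\<exists>S. finite S \<and> blocking_set G S
      \<and> card S = (LEAST m. \<exists>S. finite S \<and> blocking_set G S \<and> card S = m)"
    using LeastI_ex[OF ex] .
  then show ?thesis
    unfolding transversals_def tr_def by auto
qed

lemma transversals_iff:
  assumes "tr G = enat n"
  shows "S \<in> transversals G \<longleftrightarrow> finite S \<and> blocking_set G S \<and> card S = n"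
  using assms by (simp add: transversals_def)

text \<open>Since \<open>G\<close> is its own family of transversals, any block is a transversal, so
  its size \<open>k\<close> is the transversal number.\<close>

lemma MIF_iff:
  "MIF k G \<longleftrightarrow> uniform_family k G \<and> tr G = enat k \<and> G = transversals G"
proof
  assume M: "MIF k G"
  then obtain B where B: "B \<in> G" "card B = k"
    unfolding MIF_def uniform_family_def is_family_def by blast
  with M have "B \<in> transversals G"
    unfolding MIF_def by blast
  with B(2) have "tr G = enat k"
    by (simp add: transversals_def)
  with M show "uniform_family k G \<and> tr G = enat k \<and> G = transversals G"
    unfolding MIF_def by blast
qed (auto simp: MIF_def)

lemma blocking_family_prod:
  assumes "blocking_set G S \<or> blocking_set H S"
  shows "blocking_set (family_prod G H) S"
  using assms unfolding blocking_set_def family_prod_def by fast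

theorem theorem2p5:
  fixes X F A :: "'a set set" and k t :: nat
  assumes "MIF k X"
    and "is_family F" and "F \<subseteq> X"
    and "tr F = enat t" and "t \<le> k - 1"
    and "is_family A"
    and "point_set A \<inter> point_set (transversals F) = {}"
    and "X - F = family_prod A (transversals F)"
  shows "CIF k t F \<longleftrightarrow> MIF (k - t) A"
proof -
  define T where "T = transversals F"
  have X: "uniform_family k X" "tr X = enat k"
    and X_iff: "B \<in> X \<longleftrightarrow> finite B \<and> blocking_set X B \<and> card B = k" for B
    using assms(1) transversals_iff[of X k B] by (auto simp: MIF_iff)
  have T_iff: "B \<in> T \<longleftrightarrow> finite B \<and> blocking_set F B \<and> card B = t" for B
    unfolding T_def using assms(4) by (rule transversals_iff)
  \<comment> \<open>Blocks are non-empty, so the subtraction in \<open>t \<le> k - 1\<close> is not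
    truncated and the bound is strict.\<close>
  have "k \<noteq> 0"
    using X(1) unfolding uniform_family_def is_family_def by fastforce
  with assms(5) have "t < k" by simp
  obtain T0 where T0: "T0 \<in> T"
    using transversals_nonempty[OF assms(4)] by (auto simp: T_def)
  have disj: "P \<inter> Q = {}" if "P \<in> A" "Q \<in> T" for P Q
    using assms(7) that unfolding point_set_def T_def by blast
  have XF: "X - F = family_prod A T"
    using assms(8) by (simp add: T_def)
  have XF_iff: "B \<in> X \<and> B \<notin> F \<longleftrightarrow> (\<exists>P\<in>A. \<exists>Q\<in>T. B = P \<union> Q)" for B
  proof -
    have "B \<in> X \<and> B \<notin> F \<longleftrightarrow> B \<in> family_prod A T"
      by (simp flip: XF)
    then show ?thesis
      unfolding family_prod_def by blast
  qed
  have AT: "P \<union> Q \<in> X" if "P \<in> A" "Q \<in> T" for P Q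
    using XF_iff[of "P \<union> Q"] that by blast
  have blockX: "blocking_set X S" if "blocking_set F S" "blocking_set A S \<or> blocking_set T S" for S
  proof -
    have "blocking_set (F \<union> family_prod A T) S"
      using that blocking_family_prod by (metis blocking_set_Un)
    then show ?thesis
      using Diff_partition[OF assms(3)] XF by simp
  qed
  have k_le: "k \<le> card S" if "finite S" "blocking_set X S" for S
    using tr_le_card[OF that] X(2) by simp
  \<comment> \<open>\<open>Q\<close> already blocks \<open>F\<close>, so if it also blocked
    \<open>T\<close> it would block \<open>X\<close> with only \<open>t < k\<close> points.\<close>
  have T_not_blocking: "\<not> blocking_set T Q" if "Q \<in> T" for Q
    using that blockX[of Q] k_le[of Q] \<open>t < k\<close> by (auto simp: T_iff)
  \<comment> \<open>A block of \<open>F\<close> lies in \<open>X\<close>, hence is a transversal of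
    \<open>X\<close> and meets all of \<open>F\<close>. It meets each member of \<open>T\<close>
    because that member blocks \<open>F\<close>.\<close>
  have F_blocks: "blocking_set (F \<union> T) B" if "B \<in> F" for B
  proof -
    have "blocking_set F B"
      using that assms(3) X_iff unfolding blocking_set_def by blast
    moreover have "blocking_set T B"
      using that T_iff unfolding blocking_set_def by blast
    ultimately show ?thesis
      by (simp add: blocking_set_Un)
  qed
  have card_F: "finite B" "card B = k" if "B \<in> F" for B
    using that assms(3) X_iff by auto

  have "CIF k t F"
  proof -
    obtain B where B: "B \<in> F"
      using assms(2) unfolding is_family_def by blast
    have "tr (F \<union> T) = enat (card B)"
    proof (rule tr_eqI)
      show "card B \<le> card R" if "finite R" "blocking_set (F \<union> T) R" for R
        using that blockX k_le card_F[OF B] by (simp add: blocking_set_Un)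
    qed (use B card_F F_blocks in auto)
    then have FT_iff: "S \<in> transversals (F \<union> T)
        \<longleftrightarrow> finite S \<and> blocking_set (F \<union> T) S \<and> card S = k" for S
      using card_F[OF B] by (intro transversals_iff) simp
    have "S \<in> F" if S: "S \<in> transversals (F \<union> T)" for S
    proof (rule ccontr)
      assume "S \<notin> F"
      moreover have "S \<in> X"
        using S blockX by (auto simp: FT_iff X_iff blocking_set_Un)
      ultimately obtain P Q where PQ: "P \<in> A" "Q \<in> T" "S = P \<union> Q"
        using XF_iff[of S] by blast
      with S have "blocking_set T (P \<union> Q)"
        by (simp add: FT_iff blocking_set_Un)
      \<comment> \<open>\<open>P\<close> avoids every member of \<open>T\<close>, so
        \<open>Q\<close> alone must meet them all.\<close>
      then have "blocking_set T Q"
        using disj[OF PQ(1)] unfolding blocking_set_def by (simp add: Int_Un_distrib2)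
      with T_not_blocking PQ show False by blast
    qed
    moreover have "S \<in> transversals (F \<union> T)" if "S \<in> F" for S
      unfolding FT_iff using F_blocks[OF that] card_F[OF that] by simp
    ultimately have "F = transversals (F \<union> T)"
      by (intro set_eqI iffI)
    moreover have "F \<inter> T = {}"
      using \<open>t < k\<close> card_F(2) unfolding T_iff disjoint_iff by (metis less_irrefl)
    moreover have "uniform_family k F"
      using assms(2) card_F by (simp add: uniform_family_def)
    ultimately show ?thesis
      using assms(4,5) by (simp add: CIF_def T_def)
  qed

  moreover have "MIF (k - t) A"
  proof -
    have finA: "finite P" if "P \<in> A" for P
      using that assms(6) by (simp add: is_family_def)
    have card_A: "card P = k - t" if "P \<in> A" for P
      using card_Un_disjoint[OF finA[OF that] _ disj[OF that T0]] AT[OF that T0] T0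
      by (simp add: X_iff T_iff)
    have A_blocks: "blocking_set A P" if P: "P \<in> A" for P
      unfolding blocking_set_def
    proof
      fix R assume R: "R \<in> A"
      \<comment> \<open>With \<open>Q\<close> disjoint from \<open>T0\<close>, the blocks
        \<open>P \<union> T0\<close> and \<open>R \<union> Q\<close> of \<open>X\<close> can meet
        only inside \<open>P \<inter> R\<close>, the mixed intersections being empty as
        well.\<close>
      obtain Q where Q: "Q \<in> T" "T0 \<inter> Q = {}"
        using T_not_blocking[OF T0] unfolding blocking_set_def by blast
      have "(P \<union> T0) \<inter> (R \<union> Q) \<noteq> {}"
        using AT[OF P T0] AT[OF R Q(1)] unfolding X_iff[of "P \<union> T0"] blocking_set_def by blast
      then show "P \<inter> R \<noteq> {}"
        using Q disj[OF P Q(1)] disj[OF R T0] by blast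
    qed
    have Un_blocks: "blocking_set X (S \<union> Q)" if "blocking_set A S" "Q \<in> T" for S Q
    proof (rule blockX)
      show "blocking_set F (S \<union> Q)"
        using that(2) unfolding T_iff by (auto intro: blocking_set_mono)
      show "blocking_set A (S \<union> Q) \<or> blocking_set T (S \<union> Q)"
        using that(1) by (auto intro: blocking_set_mono)
    qed
    \<comment> \<open>Adding the \<open>t\<close> points of \<open>T0\<close> to \<open>S\<close>
      gives a blocking set of \<open>X\<close>, which has at least \<open>k\<close> points.\<close>
    have card_ge: "k - t \<le> card S" if "finite S" "blocking_set A S" for S
      using k_le[OF _ Un_blocks[OF that(2) T0]] that(1) T0 card_Un_le[of S T0]
      by (simp add: T_iff)
    obtain P where P: "P \<in> A"
      using assms(6) unfolding is_family_def by blast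
    have trA: "tr A = enat (k - t)"
      using tr_eqI[OF finA[OF P] A_blocks[OF P]] card_ge by (simp add: card_A[OF P])
    have "S \<in> A" if "finite S" "blocking_set A S" "card S = k - t" for S
    proof -
      \<comment> \<open>The union blocks \<open>X\<close>, so it has at least \<open>k\<close>
        points, while the two sizes add up to exactly \<open>k\<close>. Hence there is no overlap,
        and the union is a transversal of \<open>X\<close>.\<close>
      have ST: "S \<inter> Q = {}" "S \<union> Q \<in> X" if Q: "Q \<in> T" for Q
      proof -
        have fin: "finite Q" "card Q = t"
          using Q by (auto simp: T_iff)
        have "k \<le> card (S \<union> Q)"
          using k_le[OF _ Un_blocks] \<open>finite S\<close> \<open>blocking_set A S\<close> Q fin by blast
        moreover have "card (S \<union> Q) + card (S \<inter> Q) = k"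
          using card_Un_Int[OF \<open>finite S\<close> fin(1)] \<open>card S = k - t\<close> fin \<open>t < k\<close> by simp
        ultimately have "card (S \<inter> Q) = 0" "card (S \<union> Q) = k" by simp_all
        then show "S \<inter> Q = {}" "S \<union> Q \<in> X"
          using \<open>finite S\<close> fin Un_blocks[OF \<open>blocking_set A S\<close> Q] by (simp_all add: X_iff)
      qed
      \<comment> \<open>Blocks of \<open>F\<close> block \<open>T\<close>; as \<open>S\<close> is
        disjoint from all members of \<open>T\<close>, the set \<open>T0\<close> alone would have to
        block \<open>T\<close>.\<close>
      have "S \<union> T0 \<notin> F"
      proof
        assume "S \<union> T0 \<in> F"
        from F_blocks[OF this] have "blocking_set T (S \<union> T0)"
          by (simp add: blocking_set_Un)
        then have "blocking_set T T0"
          using ST(1) unfolding blocking_set_def by (simp add: Int_Un_distrib2)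
        with T_not_blocking[OF T0] show False ..
      qed
      then obtain P Q where PQ: "P \<in> A" "Q \<in> T" "S \<union> T0 = P \<union> Q"
        using ST(2)[OF T0] XF_iff[of "S \<union> T0"] by blast
      \<comment> \<open>\<open>S\<close> avoids \<open>Q\<close>, which gives
        \<open>S \<subseteq> P\<close>; \<open>P\<close> avoids \<open>T0\<close>, which gives
        \<open>P \<subseteq> S\<close>.\<close>
      have "S = P"
        using PQ(3) ST(1)[OF T0] ST(1)[OF PQ(2)] disj[OF PQ(1) T0] disj[OF PQ(1,2)] by blast
      with PQ(1) show ?thesis by simp
    qed
    moreover have "finite S \<and> blocking_set A S \<and> card S = k - t" if "S \<in> A" for S
      using finA[OF that] A_blocks[OF that] card_A[OF that] by simp
    ultimately have "A = transversals A"
      unfolding set_eq_iff transversals_iff[OF trA] by metis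
    then show ?thesis
      using assms(6) card_A trA by (simp add: MIF_iff uniform_family_def)
  qed
  ultimately show ?thesis by simp
qed

end
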